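(* Let $R=K[x_1,\ldots,x_n]$, with $n\geq 3$, be a polynomial ring in $n$ variables over a field $K$. Then there exist infinitely many monomial ideals in $R$ that are nearly normally torsion-free but do not satisfy the persistence property.
   Context: $\mathrm{Ass}(R/I)$ is the set of associated primes of $I$ and $\mathrm{Min}(I)$ the set of minimal primes of $I$. A monomial ideal $I \subset R = K[x_1,\dots,x_n]$ is called nearly normally torsion-free if there exist a monomial prime ideal $\mathfrak{p}$ (an ideal generated by a set of variables) and an integer $m \ge 1$ such that (i) $\operatorname{Ass}(R/I^t) = \operatorname{Min}(I)$ for all $1 \le t \le m$, and (ii) $\operatorname{Ass}(R/I^t) \subseteq \operatorname{Min}(I) \cup \{\mathfrak{p}\}$ for all $t \ge m+1$. An ideal $I$ in a commutative Noetherian ring $R$ has the persistence property if $\mathrm{Ass}(R/I^t) \subseteq \mathrm{Ass}(R/I^{t+1})$ for all $t\geq 1$. *)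

theory Defs
  imports "HOL-Algebra.Algebra" "HOL-Algebra.Algebraic_Closure_Type" "HOL-Library.Poly_Mapping" "HOL-Library.Cardinality"
begin

section \<open>Associated primes, minimal primes and persistence\<close>

definition annihilator_in_quotient ::
    "('a, 'b) ring_scheme \<Rightarrow> 'a set \<Rightarrow> 'a set \<Rightarrow> 'a set" where
  "annihilator_in_quotient R I x =
     {r \<in> carrier R. (I +>\<^bsub>R\<^esub> r) \<otimes>\<^bsub>R Quot I\<^esub> x = \<zero>\<^bsub>R Quot I\<^esub>}"

text \<open>\<open>associated_primes R I\<close> is Ass(\<open>R/I\<close>): the primes of \<open>R\<close> (not of \<open>R/I\<close>) that are
  annihilators of elements of the \<open>R\<close>-module \<open>R/I\<close>.\<close>

definition associated_primes :: "('a, 'b) ring_scheme \<Rightarrow> 'a set \<Rightarrow> 'a set set" where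
  "associated_primes R I =
     {P. primeideal P R \<and> (\<exists>x \<in> carrier (R Quot I). P = annihilator_in_quotient R I x)}"

definition minimal_primes :: "('a, 'b) ring_scheme \<Rightarrow> 'a set \<Rightarrow> 'a set set" where
  "minimal_primes R I =
     {P. primeideal P R \<and> I \<subseteq> P \<and> (\<forall>Q. primeideal Q R \<and> I \<subseteq> Q \<and> Q \<subseteq> P \<longrightarrow> Q = P)}"

text \<open>The multiplication of \<^const>\<open>ideals_set\<close> is the product of ideals, so its powers
  are the ordinary powers of ideals.\<close>

abbreviation ideal_power :: "('a, 'b) ring_scheme \<Rightarrow> 'a set \<Rightarrow> nat \<Rightarrow> 'a set" where
  "ideal_power R I t \<equiv> I [^]\<^bsub>ideals_set R\<^esub> t"

definition persistence_property :: "('a, 'b) ring_scheme \<Rightarrow> 'a set \<Rightarrow> bool" where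
  "persistence_property R I \<longleftrightarrow>
     (\<forall>t\<ge>1. associated_primes R (ideal_power R I t)
             \<subseteq> associated_primes R (ideal_power R I (t + 1)))"

section \<open>Monomial ideals\<close>

text \<open>The variables are indexed by a finite type \<open>'n\<close>; an element of \<open>'n \<Rightarrow>\<^sub>0 nat\<close> is an
  exponent vector, and the product of \<^typ>\<open>('n \<Rightarrow>\<^sub>0 nat) \<Rightarrow>\<^sub>0 'k::field\<close> is the convolution
  product, i.e. the product of polynomials.\<close>

type_synonym ('n, 'k) mpoly = "('n \<Rightarrow>\<^sub>0 nat) \<Rightarrow>\<^sub>0 'k"

abbreviation mpoly_ring :: "('n::finite, 'k::field) mpoly ring" where
  "mpoly_ring \<equiv> ring_of_type_algebra"

definition monomial :: "('n::finite \<Rightarrow>\<^sub>0 nat) \<Rightarrow> ('n, 'k::field) mpoly" where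
  "monomial e = Poly_Mapping.single e 1"

definition variable :: "'n::finite \<Rightarrow> ('n, 'k::field) mpoly" where
  "variable i = monomial (Poly_Mapping.single i 1)"

definition monomial_ideal :: "('n::finite, 'k::field) mpoly set \<Rightarrow> bool" where
  "monomial_ideal I \<longleftrightarrow> (\<exists>E. I = Idl\<^bsub>mpoly_ring\<^esub> (monomial ` E))"

definition monomial_prime_ideal :: "('n::finite, 'k::field) mpoly set \<Rightarrow> bool" where
  "monomial_prime_ideal P \<longleftrightarrow> (\<exists>V. P = Idl\<^bsub>mpoly_ring\<^esub> (variable ` V))"

definition nearly_normally_torsion_free :: "('n::finite, 'k::field) mpoly set \<Rightarrow> bool" where
  "nearly_normally_torsion_free I \<longleftrightarrow>
     monomial_ideal I \<and>
     (\<exists>P m. monomial_prime_ideal P \<and> m \<ge> 1 \<and>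
        (\<forall>t. 1 \<le> t \<and> t \<le> m \<longrightarrow>
           associated_primes mpoly_ring (ideal_power mpoly_ring I t)
             = minimal_primes mpoly_ring I) \<and>
        (\<forall>t\<ge>m + 1.
           associated_primes mpoly_ring (ideal_power mpoly_ring I t)
             \<subseteq> minimal_primes mpoly_ring I \<union> {P}))"

end

theory Submission
  imports Defs "HOL-Library.Set_Algebras" "HOL-Library.Product_Plus"
begin

text \<open>
  Choose three variables \<open>x\<close>, \<open>y\<close>, \<open>z\<close> and, for \<open>c \<ge> 3\<close>, let \<open>I\<close> be the ideal generated by
  \<open>x\<^sup>5z\<^sup>c\<close>, \<open>x\<^sup>4yz\<^sup>c\<close>, \<open>x\<^sup>2y\<^sup>3z\<^sup>c\<close>, \<open>xy\<^sup>4z\<close>, \<open>y\<^sup>5\<close>. These ideals are pairwise distinct, since \<open>c\<close> can be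
  read off, so it suffices that each of them is nearly normally torsion-free without having the
  persistence property.

  An associated prime of a monomial ideal is generated by variables
  (\<open>associated_prime_eq_variable_prime\<close>). The monomials \<open>y\<^sup>5\<close> and \<open>x\<^sup>5z\<^sup>c\<close> in \<open>I\<close> therefore leave only
  \<open>(x, y)\<close>, \<open>(y, z)\<close> and \<open>(x, y, z)\<close> as possible associated primes of a power of \<open>I\<close>
  (\<open>associated_primes_power_staircase_ideal_subset\<close>). The first two are the minimal primes of
  \<open>I\<close> and they are associated to \<open>I\<close>. Hence everything depends on when \<open>(x, y, z)\<close> is associated to
  \<open>I\<^sup>t\<close>, which means that some monomial outside \<open>I\<^sup>t\<close> is multiplied into \<open>I\<^sup>t\<close> by each of \<open>x\<close>, \<open>y\<close>, \<open>z\<close>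
  (\<open>associated_xyz_prime_iff_socle\<close>).

  For fixed \<open>y\<close>-degree, the monomials of \<open>I\<^sup>t\<close> in \<open>x\<close>, \<open>y\<close>, \<open>z\<close> have a least \<open>x\<close>-degree and a least \<open>z\<close>-degree. If both
  are always attained by the same monomial, then membership in \<open>I\<^sup>t\<close> is a condition on the \<open>x\<close>-degree
  together with a condition on the \<open>z\<close>-degree, and no such socle monomial exists. This is the case
  for \<open>t = 1\<close> by construction, so \<open>I\<close> is nearly normally torsion-free with \<open>m = 1\<close> and the prime
  \<open>(x, y, z)\<close>. It fails for \<open>t = 2\<close>: the generators skip \<open>x\<^sup>3y\<^sup>2z\<^sup>c\<close>, so in \<open>y\<close>-degree 7 the least \<open>x\<close>-degree
  3 costs an additional factor \<open>z\<close>, and \<open>x\<^sup>3y\<^sup>7z\<^sup>c\<close> is a socle monomial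
  (\<open>staircase_square_socle\<close>). It holds again for \<open>t = 3\<close> (\<open>staircase_cube_saturated\<close>),
  because three factors suffice to go around the gap. So \<open>(x, y, z)\<close> is associated to \<open>I\<^sup>2\<close> but not to
  \<open>I\<^sup>3\<close>.

  Membership in a monomial ideal is a condition on exponents, and products of ideals correspond to
  sums of sets of exponents; as the ideals only involve three variables, all computations take place
  in \<^typ>\<open>nat \<times> nat \<times> nat\<close>.
\<close>

section \<open>Monomial ideals as sets of exponents\<close>

definition monomial_span :: "('n::finite \<Rightarrow>\<^sub>0 nat) set \<Rightarrow> ('n, 'k::field) mpoly set" where
  "monomial_span U = {f. Poly_Mapping.keys f \<subseteq> U}"

definition upward_closed :: "('a::plus) set \<Rightarrow> bool" where
  "upward_closed U \<longleftrightarrow> (\<forall>e\<in>U. \<forall>d. e + d \<in> U)"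

lemma upward_closedD: "upward_closed U \<Longrightarrow> e \<in> U \<Longrightarrow> e + d \<in> U"
  by (simp add: upward_closed_def)

lemma upward_closedD2:
  fixes U :: "'a::ab_semigroup_add set"
  shows "upward_closed U \<Longrightarrow> e \<in> U \<Longrightarrow> d + e \<in> U"
  by (metis add.commute upward_closedD)

lemma mpoly_ring_simps [simp]:
  "partial_object.carrier mpoly_ring = UNIV" "monoid.mult mpoly_ring = (*)" "monoid.one mpoly_ring = 1"
  "ring.zero mpoly_ring = 0" "ring.add mpoly_ring = (+)"
  by (auto simp: ring_of_type_algebra_def)

lemma cring_mpoly_ring: "cring (mpoly_ring :: ('n::finite, 'k::field) mpoly ring)"
  by (rule cring_from_type_algebra)

lemma ring_mpoly_ring: "ring (mpoly_ring :: ('n::finite, 'k::field) mpoly ring)"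
  by (rule ring_from_type_algebra)

lemma poly_mapping_eq_sum_singles:
  "f = (\<Sum>e\<in>Poly_Mapping.keys f. Poly_Mapping.single e (Poly_Mapping.lookup f e))"
  by (rule poly_mapping_eqI)
     (auto simp: lookup_sum lookup_single when_def sum.delta' in_keys_iff)

lemma monomial_span_0 [simp]: "0 \<in> monomial_span U"
  by (simp add: monomial_span_def)

lemma monomial_span_add:
  "f \<in> monomial_span U \<Longrightarrow> g \<in> monomial_span U \<Longrightarrow> f + g \<in> monomial_span U"
  using keys_add[of f g] by (auto simp: monomial_span_def)

lemma monomial_span_uminus: "f \<in> monomial_span U \<Longrightarrow> - f \<in> monomial_span U"
  by (auto simp: monomial_span_def in_keys_iff)

lemma monomial_span_diff:
  "f \<in> monomial_span U \<Longrightarrow> g \<in> monomial_span U \<Longrightarrow> f - g \<in> monomial_span U"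
  using monomial_span_add[of f U "- g"] monomial_span_uminus[of g U] by simp

lemma monomial_in_span_iff: "monomial e \<in> monomial_span U \<longleftrightarrow> e \<in> U"
  by (simp add: monomial_span_def monomial_def)

lemma monomial_span_mult:
  assumes "upward_closed U" "f \<in> monomial_span U"
  shows "g * f \<in> monomial_span U"
proof -
  have "Poly_Mapping.keys (g * f) \<subseteq> {a + b | a b. a \<in> Poly_Mapping.keys g \<and> b \<in> Poly_Mapping.keys f}"
    by (rule keys_mult)
  also have "\<dots> \<subseteq> U"
    using assms upward_closedD2[OF assms(1)] by (auto simp: monomial_span_def)
  finally show ?thesis
    by (simp add: monomial_span_def)
qed

lemma ideal_mpoly_ringI:
  assumes "0 \<in> I" "\<And>f g. f \<in> I \<Longrightarrow> g \<in> I \<Longrightarrow> f + g \<in> I" "\<And>f g. g \<in> I \<Longrightarrow> f * g \<in> I"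
  shows "ideal I (mpoly_ring :: ('n::finite, 'k::field) mpoly ring)"
proof (rule idealI[OF ring_mpoly_ring])
  interpret ring "mpoly_ring :: ('n, 'k) mpoly ring" by (rule ring_mpoly_ring)
  show "subgroup I (add_monoid (mpoly_ring :: ('n, 'k) mpoly ring))"
  proof
    fix f assume f: "f \<in> I"
    have "\<ominus>\<^bsub>mpoly_ring\<^esub> f = - f"
      by (rule minus_equality) auto
    then show "inv\<^bsub>add_monoid mpoly_ring\<^esub> f \<in> I"
      using assms(3)[OF f, of "-1"] by (simp add: a_inv_def)
  qed (use assms in auto)
qed (use assms in \<open>auto simp: mult.commute\<close>)

lemma ideal_monomial_span:
  "upward_closed U \<Longrightarrow> ideal (monomial_span U) (mpoly_ring :: ('n::finite, 'k::field) mpoly ring)"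
  by (rule ideal_mpoly_ringI) (auto intro: monomial_span_add monomial_span_mult)

lemma mpoly_ideal_closed:
  assumes "ideal I (mpoly_ring :: ('n::finite, 'k::field) mpoly ring)"
  shows "0 \<in> I" "f \<in> I \<Longrightarrow> g \<in> I \<Longrightarrow> f + g \<in> I" "f \<in> I \<Longrightarrow> g * f \<in> I"
  using additive_subgroup.zero_closed[OF ideal.axioms(1)[OF assms]]
    additive_subgroup.a_closed[OF ideal.axioms(1)[OF assms], of f g]
    ideal.I_l_closed[OF assms, of f g]
  by auto

lemma mpoly_ideal_sum:
  assumes "ideal I (mpoly_ring :: ('n::finite, 'k::field) mpoly ring)"
    "\<And>a. a \<in> A \<Longrightarrow> f a \<in> I"
  shows "sum f A \<in> I"
  using assms(2)
  by (induction A rule: infinite_finite_induct) (auto intro: mpoly_ideal_closed[OF assms(1)])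

lemma single_eq_coeff_times_monomial:
  "Poly_Mapping.single e c = Poly_Mapping.single 0 c * monomial e"
  by (simp add: monomial_def mult_single)

lemma monomial_add: "monomial (d + e) = monomial d * monomial e"
  by (simp add: monomial_def mult_single)

lemma monomial_span_subset_ideal:
  assumes "ideal I (mpoly_ring :: ('n::finite, 'k::field) mpoly ring)"
    "\<And>e. e \<in> U \<Longrightarrow> monomial e \<in> I"
  shows "monomial_span U \<subseteq> I"
proof
  fix f :: "('n, 'k) mpoly"
  assume "f \<in> monomial_span U"
  then have "Poly_Mapping.single e c \<in> I" if "e \<in> Poly_Mapping.keys f" for e c
    unfolding single_eq_coeff_times_monomial[of e c] using that
    by (intro mpoly_ideal_closed(3)[OF assms(1)] assms(2)) (auto simp: monomial_span_def)
  then have "(\<Sum>e\<in>Poly_Mapping.keys f. Poly_Mapping.single e (Poly_Mapping.lookup f e)) \<in> I"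
    by (intro mpoly_ideal_sum[OF assms(1)])
  then show "f \<in> I"
    by (simp flip: poly_mapping_eq_sum_singles)
qed

text \<open>The generators need not be closed under multiples; adding \<open>UNIV\<close> closes them.\<close>

lemma genideal_monomials:
  "Idl\<^bsub>(mpoly_ring :: ('n::finite, 'k::field) mpoly ring)\<^esub> (monomial ` E) = monomial_span (E + UNIV)"
proof
  interpret ring "mpoly_ring :: ('n, 'k) mpoly ring" by (rule ring_mpoly_ring)
  have up: "upward_closed (E + UNIV)"
    by (auto simp: upward_closed_def set_plus_def) (metis add.assoc)
  show "Idl\<^bsub>mpoly_ring\<^esub> (monomial ` E) \<subseteq> (monomial_span (E + UNIV) :: ('n, 'k) mpoly set)"
    by (intro genideal_minimal ideal_monomial_span up)
       (auto simp: monomial_in_span_iff set_plus_def, metis add_0_right)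
  show "(monomial_span (E + UNIV) :: ('n, 'k) mpoly set) \<subseteq> Idl\<^bsub>mpoly_ring\<^esub> (monomial ` E)"
  proof (rule monomial_span_subset_ideal)
    show id: "ideal (Idl\<^bsub>mpoly_ring\<^esub> (monomial ` E)) (mpoly_ring :: ('n, 'k) mpoly ring)"
      by (rule genideal_ideal) auto
    fix e assume "e \<in> E + UNIV"
    then obtain a d where "a \<in> E" "e = d + a"
      by (auto simp: set_plus_def add.commute)
    moreover have "(monomial a :: ('n, 'k) mpoly) \<in> Idl\<^bsub>mpoly_ring\<^esub> (monomial ` E)" if "a \<in> E"
      using genideal_self[of "monomial ` E"] that by auto
    ultimately show "(monomial e :: ('n, 'k) mpoly) \<in> Idl\<^bsub>mpoly_ring\<^esub> (monomial ` E)"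
      by (auto simp: monomial_add intro: mpoly_ideal_closed[OF id])
  qed
qed

lemma upward_closed_plus:
  fixes U W :: "'a::ab_semigroup_add set"
  shows "upward_closed W \<Longrightarrow> upward_closed (U + W)"
  by (auto simp: upward_closed_def set_plus_def) (metis add.assoc)

lemma ideal_prod_monomial_span:
  assumes "upward_closed U" "upward_closed W"
  shows "ideal_prod (mpoly_ring :: ('n::finite, 'k::field) mpoly ring) (monomial_span U) (monomial_span W)
    = monomial_span (U + W)" (is "?P = _")
proof
  show "?P \<subseteq> monomial_span (U + W)"
  proof
    fix f assume "f \<in> ?P"
    then show "f \<in> monomial_span (U + W)"
    proof (induction rule: ideal_prod.induct)
      case (prod f g)
      then show ?case
        using keys_mult[of f g] by (fastforce simp: monomial_span_def set_plus_def)
    next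
      case (sum f g)
      then show ?case by (simp add: monomial_span_add)
    qed
  qed
  show "monomial_span (U + W) \<subseteq> ?P"
  proof (rule monomial_span_subset_ideal)
    show "ideal ?P mpoly_ring"
      by (intro ring.ideal_prod_is_ideal ring_mpoly_ring ideal_monomial_span assms)
    fix e assume "e \<in> U + W"
    then obtain a b where "a \<in> U" "b \<in> W" "e = a + b"
      by (auto simp: set_plus_def)
    then show "monomial e \<in> ?P"
      using ideal_prod.prod[of "monomial a" "monomial_span U" "monomial b" "monomial_span W" mpoly_ring]
      by (simp add: monomial_add monomial_in_span_iff)
  qed
qed

text \<open>The zeroth power is \<open>UNIV\<close>, and not \<open>{0}\<close>, because the zeroth power of an ideal is the
  whole ring. On upward closed sets the recursion then yields the set itself as first power.\<close>

primrec sumset_power :: "('a::plus) set \<Rightarrow> nat \<Rightarrow> 'a set" where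
  "sumset_power U 0 = UNIV"
| "sumset_power U (Suc t) = sumset_power U t + U"

lemma upward_closed_sumset_power:
  fixes U :: "'a::ab_semigroup_add set"
  shows "upward_closed U \<Longrightarrow> upward_closed (sumset_power U t)"
  by (cases t) (auto intro: upward_closed_plus, simp add: upward_closed_def)

lemma ideal_power_monomial_span:
  assumes "upward_closed U"
  shows "ideal_power (mpoly_ring :: ('n::finite, 'k::field) mpoly ring) (monomial_span U) t
    = monomial_span (sumset_power U t)"
proof (induction t)
  case 0
  show ?case
    by (simp add: ideals_set_def nat_pow_def monomial_span_def)
next
  case (Suc t)
  then show ?case
    using ideal_prod_monomial_span[OF upward_closed_sumset_power[OF assms, of t] assms]
    by (simp add: ideals_set_def nat_pow_def)
qed

section \<open>Nonzerodivisors modulo monomial ideals\<close>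

lemma lookup_mult_sum:
  "Poly_Mapping.lookup (g * f) k =
    (\<Sum>a\<in>Poly_Mapping.keys g. \<Sum>b\<in>Poly_Mapping.keys f.
       Poly_Mapping.lookup g a * Poly_Mapping.lookup f b when a + b = k)"
proof -
  have "g * f = (\<Sum>a\<in>Poly_Mapping.keys g. \<Sum>b\<in>Poly_Mapping.keys f.
     Poly_Mapping.single (a + b) (Poly_Mapping.lookup g a * Poly_Mapping.lookup f b))"
    using arg_cong2[OF poly_mapping_eq_sum_singles[of g] poly_mapping_eq_sum_singles[of f], of "(*)"]
    by (simp only: sum_product mult_single)
  then show ?thesis
    by (simp add: lookup_sum lookup_single)
qed

text \<open>The index type of the variables carries no order, so there is no monomial order to begin
  with. Numbering the variables embeds the exponents additively into \<^typ>\<open>nat \<Rightarrow>\<^sub>0 nat\<close>, whose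
  lexicographic order is compatible with addition; pulled back, it is a monomial order.\<close>

lemma exponent_order_embedding:
  obtains \<phi> :: "('n::finite \<Rightarrow>\<^sub>0 nat) \<Rightarrow> (nat \<Rightarrow>\<^sub>0 nat)"
  where "inj \<phi>" "\<And>a b. \<phi> (a + b) = \<phi> a + \<phi> b"
proof -
  obtain h :: "'n \<Rightarrow> nat" where h: "inj h"
    using finite_imp_inj_to_nat_seg[OF finite_class.finite_UNIV] by blast
  define \<phi> where "\<phi> e = (\<Sum>i\<in>UNIV. Poly_Mapping.single (h i) (Poly_Mapping.lookup e i))"
    for e :: "'n \<Rightarrow>\<^sub>0 nat"
  have "Poly_Mapping.lookup (\<phi> e) (h i) = Poly_Mapping.lookup e i" for e i
    using h by (simp add: \<phi>_def lookup_sum lookup_single when_def inj_eq)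
  then have "inj \<phi>"
    by (metis injI poly_mapping_eqI)
  moreover have "\<phi> (a + b) = \<phi> a + \<phi> b" for a b
    by (simp add: \<phi>_def lookup_add single_add sum.distrib)
  ultimately show ?thesis
    using that by blast
qed

text \<open>The leading exponents of the factors add up to an exponent that no other pair of
  exponents can produce, so its coefficient does not cancel.\<close>

lemma product_has_leading_exponent:
  fixes f g :: "('n::finite, 'k::field) mpoly"
  assumes "f \<noteq> 0" "g \<noteq> 0"
  obtains a b where "a \<in> Poly_Mapping.keys g" "b \<in> Poly_Mapping.keys f"
    "a + b \<in> Poly_Mapping.keys (g * f)"
proof -
  obtain \<phi> :: "('n \<Rightarrow>\<^sub>0 nat) \<Rightarrow> (nat \<Rightarrow>\<^sub>0 nat)"
    where \<phi>: "inj \<phi>" "\<And>a b. \<phi> (a + b) = \<phi> a + \<phi> b"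
    using exponent_order_embedding by blast
  have ex: "\<exists>m\<in>Poly_Mapping.keys p. \<forall>a\<in>Poly_Mapping.keys p. \<phi> a \<le> \<phi> m"
    if "p \<noteq> 0" for p :: "('n, 'k) mpoly"
  proof -
    have "Max (\<phi> ` Poly_Mapping.keys p) \<in> \<phi> ` Poly_Mapping.keys p"
      using that by (intro Max_in) auto
    then show ?thesis
      by (metis (no_types, lifting) Max_ge finite_imageI finite_keys image_eqI imageE)
  qed
  obtain a where a: "a \<in> Poly_Mapping.keys g" "\<forall>a'\<in>Poly_Mapping.keys g. \<phi> a' \<le> \<phi> a"
    using ex[OF assms(2)] by blast
  obtain b where b: "b \<in> Poly_Mapping.keys f" "\<forall>b'\<in>Poly_Mapping.keys f. \<phi> b' \<le> \<phi> b"
    using ex[OF assms(1)] by blast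
  have uniq: "a' + b' = a + b \<longleftrightarrow> a' = a \<and> b' = b"
    if "a' \<in> Poly_Mapping.keys g" "b' \<in> Poly_Mapping.keys f" for a' b'
  proof
    assume eq: "a' + b' = a + b"
    then have "\<phi> a' + \<phi> b' = \<phi> a + \<phi> b"
      by (metis \<phi>(2))
    moreover have "\<phi> a' \<le> \<phi> a" "\<phi> b' \<le> \<phi> b"
      using a b that by auto
    ultimately have "\<phi> a' = \<phi> a"
      by (metis add_le_less_mono add_less_le_mono order_less_irrefl order_le_less)
    then have "a' = a"
      using \<phi>(1) by (simp add: inj_eq)
    with eq show "a' = a \<and> b' = b"
      by simp
  qed simp
  have "Poly_Mapping.lookup (g * f) (a + b) =
    (\<Sum>a'\<in>Poly_Mapping.keys g. \<Sum>b'\<in>Poly_Mapping.keys f.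
       if a' = a then if b' = b then Poly_Mapping.lookup g a * Poly_Mapping.lookup f b else 0 else 0)"
    unfolding lookup_mult_sum by (intro sum.cong refl) (auto simp: when_def uniq)
  also have "\<dots> = (\<Sum>a'\<in>Poly_Mapping.keys g.
       if a' = a then Poly_Mapping.lookup g a * Poly_Mapping.lookup f b else 0)"
    using b by (intro sum.cong refl) auto
  also have "\<dots> = Poly_Mapping.lookup g a * Poly_Mapping.lookup f b"
    using a by simp
  finally show ?thesis
    using a b that[of a b] by (simp add: in_keys_iff)
qed

lemma mpoly_split:
  fixes f :: "('n::finite, 'k::field) mpoly"
  obtains f\<^sub>1 f\<^sub>2 where "f = f\<^sub>1 + f\<^sub>2" "Poly_Mapping.keys f\<^sub>1 = Poly_Mapping.keys f \<inter> U"
    "Poly_Mapping.keys f\<^sub>2 = Poly_Mapping.keys f - U"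
proof -
  have part: "\<exists>p :: ('n, 'k) mpoly. \<forall>e. Poly_Mapping.lookup p e = (Poly_Mapping.lookup f e when e \<in> S)"
    for S
  proof -
    have "finite {e. (Poly_Mapping.lookup f e when e \<in> S) \<noteq> 0}"
      by (rule finite_subset[OF _ finite_keys[of f]]) (auto simp: in_keys_iff when_def)
    then show ?thesis
      by (intro exI[of _ "Abs_poly_mapping (\<lambda>e. Poly_Mapping.lookup f e when e \<in> S)"]) simp
  qed
  obtain p where p: "\<forall>e. Poly_Mapping.lookup p e = (Poly_Mapping.lookup f e when e \<in> U)"
    using part by blast
  obtain q where q: "\<forall>e. Poly_Mapping.lookup q e = (Poly_Mapping.lookup f e when e \<in> - U)"
    using part by blast
  have "f = p + q"
    by (rule poly_mapping_eqI) (auto simp: lookup_add p q when_def)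
  then show ?thesis
    by (rule that) (auto simp: in_keys_iff p q when_def split: if_splits)
qed

definition avoiding :: "'n::finite set \<Rightarrow> ('n \<Rightarrow>\<^sub>0 nat) set" where
  "avoiding V = {d. Poly_Mapping.keys d \<inter> V = {}}"

text \<open>The exponents in \<open>U\<close> are recognised by their entries at \<open>V\<close>; for upward closed \<open>U\<close>, the
  corresponding ideal is then generated by monomials in the variables in \<open>V\<close>.\<close>

definition determined_by :: "'n::finite set \<Rightarrow> ('n \<Rightarrow>\<^sub>0 nat) set \<Rightarrow> bool" where
  "determined_by V U \<longleftrightarrow> (\<forall>e. \<forall>d \<in> avoiding V. e + d \<in> U \<longleftrightarrow> e \<in> U)"

text \<open>Remove from \<open>f\<close> the terms that already lie in the ideal. If some terms survived, a leading
  exponent \<open>a + b\<close> of the product with \<open>g\<close> would lie in \<open>U\<close>; since \<open>a\<close> involves no variable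
  of \<open>V\<close>, already \<open>b\<close> would, although \<open>b\<close> was a surviving exponent.\<close>

lemma nonzerodivisor_mod_monomial_span:
  fixes f g :: "('n::finite, 'k::field) mpoly"
  assumes "upward_closed U" "determined_by V U"
    and "g \<noteq> 0" "Poly_Mapping.keys g \<subseteq> avoiding V" "g * f \<in> monomial_span U"
  shows "f \<in> monomial_span U"
proof -
  obtain f\<^sub>1 f\<^sub>2 where f: "f = f\<^sub>1 + f\<^sub>2" "Poly_Mapping.keys f\<^sub>1 = Poly_Mapping.keys f \<inter> U"
    "Poly_Mapping.keys f\<^sub>2 = Poly_Mapping.keys f - U"
    by (rule mpoly_split)
  have f1: "f\<^sub>1 \<in> monomial_span U"
    using f by (simp add: monomial_span_def)
  have "g * f\<^sub>2 = g * f - g * f\<^sub>1"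
    by (simp add: f algebra_simps)
  also have "\<dots> \<in> monomial_span U"
    by (intro monomial_span_diff[OF assms(5)] monomial_span_mult[OF assms(1) f1])
  finally have gf2: "g * f\<^sub>2 \<in> monomial_span U" .
  have "f\<^sub>2 = 0"
  proof (rule ccontr)
    assume "f\<^sub>2 \<noteq> 0"
    then obtain a b where ab: "a \<in> Poly_Mapping.keys g" "b \<in> Poly_Mapping.keys f\<^sub>2"
      "a + b \<in> Poly_Mapping.keys (g * f\<^sub>2)"
      using product_has_leading_exponent assms(3) by blast
    have "b + a \<in> U"
      using ab gf2 by (auto simp: monomial_span_def add.commute)
    then have "b \<in> U"
      using ab assms unfolding determined_by_def by blast
    then show False
      using ab f by blast
  qed
  then show ?thesis
    using f f1 by simp
qed

section \<open>Associated primes of monomial ideals\<close>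

lemma exponent_split_variable:
  fixes e :: "'n::finite \<Rightarrow>\<^sub>0 nat"
  assumes "i \<in> Poly_Mapping.keys e"
  shows "e = Poly_Mapping.single i 1 + (e - Poly_Mapping.single i 1)"
  by (rule poly_mapping_eqI)
     (use assms in \<open>auto simp: lookup_add lookup_minus lookup_single when_def in_keys_iff\<close>)

lemma keys_monomial_mult:
  "Poly_Mapping.keys (monomial d * f) = (+) d ` Poly_Mapping.keys f"
proof
  show "Poly_Mapping.keys (monomial d * f) \<subseteq> (+) d ` Poly_Mapping.keys f"
    using keys_mult[of "monomial d" f] by (auto simp: monomial_def)
  have "Poly_Mapping.lookup (monomial d * f) (d + e) = Poly_Mapping.lookup f e" for e
    unfolding lookup_mult_sum by (auto simp: monomial_def when_def in_keys_iff)
  then show "(+) d ` Poly_Mapping.keys f \<subseteq> Poly_Mapping.keys (monomial d * f)"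
    by (auto simp: in_keys_iff)
qed

lemma monomial_mult_in_span_iff:
  "monomial d * f \<in> monomial_span U \<longleftrightarrow> (\<forall>e\<in>Poly_Mapping.keys f. d + e \<in> U)"
  by (auto simp: monomial_span_def keys_monomial_mult)

text \<open>Cosets are represented by polynomials, which turns annihilators in the quotient module into
  colon ideals.\<close>

lemma associated_primes_mpoly_ring:
  fixes J :: "('n::finite, 'k::field) mpoly set"
  assumes J: "ideal J mpoly_ring"
  shows "associated_primes mpoly_ring J =
    {P. primeideal P mpoly_ring \<and> (\<exists>f. P = {r. r * f \<in> J})}"
proof -
  interpret ideal J "mpoly_ring :: ('n, 'k) mpoly ring" by (rule J)
  have zero: "J +>\<^bsub>mpoly_ring\<^esub> h = J \<longleftrightarrow> h \<in> J" for h
    using a_rcos_self[of h] a_rcos_const[of h] by auto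
  have "annihilator_in_quotient mpoly_ring J (J +>\<^bsub>mpoly_ring\<^esub> f) = {r. r * f \<in> J}" for f
    using rcoset_mult_add[of _ f]
    by (simp add: annihilator_in_quotient_def FactRing_def zero)
  then show ?thesis
    by (auto simp: associated_primes_def FactRing_def A_RCOSETS_def')
qed

text \<open>The ideal generated by the variables in \<open>V\<close>: a monomial lies in it when it involves one of
  them.\<close>

abbreviation variable_prime :: "'n::finite set \<Rightarrow> ('n, 'k::field) mpoly set" where
  "variable_prime V \<equiv> monomial_span (- avoiding V)"

lemma avoiding_add: "d + e \<in> avoiding V \<longleftrightarrow> d \<in> avoiding V \<and> e \<in> avoiding V"
  for d :: "'n::finite \<Rightarrow>\<^sub>0 nat"
  by (auto simp: avoiding_def disjoint_iff in_keys_iff lookup_add)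

lemma zero_in_avoiding [simp]: "0 \<in> avoiding V"
  by (simp add: avoiding_def)

lemma avoiding_sum:
  fixes \<delta> :: "'a \<Rightarrow> ('n::finite \<Rightarrow>\<^sub>0 nat)"
  shows "(\<And>a. a \<in> A \<Longrightarrow> \<delta> a \<in> avoiding V) \<Longrightarrow> sum \<delta> A \<in> avoiding V"
  by (induction A rule: infinite_finite_induct) (auto simp: avoiding_add)

lemma upward_closed_Compl_avoiding: "upward_closed (- avoiding V)"
  by (simp add: upward_closed_def avoiding_add)

lemma determined_by_Compl_avoiding: "determined_by V (- avoiding V)"
  by (simp add: determined_by_def avoiding_add)

lemma variable_in_variable_prime_iff: "variable i \<in> variable_prime V \<longleftrightarrow> i \<in> V"
  by (simp add: variable_def monomial_in_span_iff avoiding_def)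

lemma variable_prime_subset_iff:
  "(variable_prime V :: ('n::finite, 'k::field) mpoly set) \<subseteq> variable_prime W \<longleftrightarrow> V \<subseteq> W"
proof
  assume "(variable_prime V :: ('n, 'k) mpoly set) \<subseteq> variable_prime W"
  then show "V \<subseteq> W"
    using variable_in_variable_prime_iff by blast
qed (auto simp: monomial_span_def avoiding_def)

text \<open>Modulo the ideal, a factor \<open>g\<close> is congruent to a polynomial \<open>g\<^sub>2\<close> without variables from \<open>V\<close>,
  which is either zero or a nonzerodivisor.\<close>

lemma primeideal_variable_prime:
  "primeideal (variable_prime V) (mpoly_ring :: ('n::finite, 'k::field) mpoly ring)"
proof (rule primeidealI)
  show "ideal (variable_prime V) (mpoly_ring :: ('n, 'k) mpoly ring)"
    by (intro ideal_monomial_span upward_closed_Compl_avoiding)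
  show "carrier mpoly_ring \<noteq> (variable_prime V :: ('n, 'k) mpoly set)"
  proof
    assume "carrier mpoly_ring = (variable_prime V :: ('n, 'k) mpoly set)"
    then have "(1 :: ('n, 'k) mpoly) \<in> variable_prime V"
      by auto
    then show False
      by (simp add: monomial_span_def avoiding_def)
  qed
next
  fix g f :: "('n, 'k) mpoly"
  assume gf: "g \<otimes>\<^bsub>mpoly_ring\<^esub> f \<in> variable_prime V"
  obtain g\<^sub>1 g\<^sub>2 where g: "g = g\<^sub>1 + g\<^sub>2" "Poly_Mapping.keys g\<^sub>1 = Poly_Mapping.keys g \<inter> - avoiding V"
    "Poly_Mapping.keys g\<^sub>2 = Poly_Mapping.keys g - (- avoiding V)"
    by (rule mpoly_split)
  have "f \<in> variable_prime V" if "g\<^sub>2 \<noteq> 0"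
  proof (rule nonzerodivisor_mod_monomial_span[OF _ determined_by_Compl_avoiding that])
    have "g * f - f * g\<^sub>1 \<in> variable_prime V"
    proof (rule monomial_span_diff)
      show "g * f \<in> variable_prime V"
        using gf by simp
      show "f * g\<^sub>1 \<in> variable_prime V"
        using g by (intro monomial_span_mult upward_closed_Compl_avoiding) (auto simp: monomial_span_def)
    qed
    then show "g\<^sub>2 * f \<in> variable_prime V"
      by (simp add: g algebra_simps)
  qed (use g upward_closed_Compl_avoiding in auto)
  moreover have "g \<in> variable_prime V" if "g\<^sub>2 = 0"
    using g that by (auto simp: monomial_span_def)
  ultimately show "g \<in> variable_prime V \<or> f \<in> variable_prime V"
    by blast
qed (rule cring_mpoly_ring)

lemma one_notin_primeideal:
  assumes "primeideal P (mpoly_ring :: ('n::finite, 'k::field) mpoly ring)"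
  shows "1 \<notin> P"
  using primeideal.I_notcarr[OF assms] ideal.one_imp_carrier[OF primeideal.axioms(1)[OF assms]]
  by auto

lemma monomial_in_primeideal_imp_variable:
  assumes P: "primeideal P (mpoly_ring :: ('n::finite, 'k::field) mpoly ring)"
    and "monomial d \<in> P"
  shows "\<exists>i\<in>Poly_Mapping.keys d. variable i \<in> P"
  using assms(2)
proof (induction "\<Sum>i\<in>UNIV. Poly_Mapping.lookup d i" arbitrary: d rule: less_induct)
  case less
  show ?case
  proof (cases "d = 0")
    case True
    then show ?thesis
      using less.prems one_notin_primeideal[OF P] by (simp add: monomial_def)
  next
    case False
    then obtain i where i: "i \<in> Poly_Mapping.keys d"
      by (metis ex_in_conv keys_eq_empty)
    define d' where "d' = d - Poly_Mapping.single i 1"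
    have d: "d = Poly_Mapping.single i 1 + d'"
      unfolding d'_def by (rule exponent_split_variable[OF i])
    have sub: "Poly_Mapping.keys d' \<subseteq> Poly_Mapping.keys d"
      by (auto simp: d in_keys_iff lookup_add)
    have lt: "(\<Sum>i\<in>UNIV. Poly_Mapping.lookup d' i) < (\<Sum>i\<in>UNIV. Poly_Mapping.lookup d i)"
      by (simp add: d lookup_add lookup_single when_def sum.distrib)
    have "variable i * monomial d' \<in> P"
      using less.prems by (simp add: d monomial_add variable_def)
    then have "variable i \<in> P \<or> monomial d' \<in> P"
      using primeideal.I_prime[OF P, of "variable i" "monomial d'"] by simp
    then show ?thesis
      using i sub less.hyps[OF lt] by blast
  qed
qed

lemma variable_prime_subset_prime:
  assumes "primeideal P (mpoly_ring :: ('n::finite, 'k::field) mpoly ring)"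
    and "\<And>i. i \<in> V \<Longrightarrow> variable i \<in> P"
  shows "variable_prime V \<subseteq> P"
proof (rule monomial_span_subset_ideal)
  show id: "ideal P mpoly_ring"
    using assms(1) by (rule primeideal.axioms)
  fix e :: "'n \<Rightarrow>\<^sub>0 nat" assume "e \<in> - avoiding V"
  then obtain i where i: "i \<in> Poly_Mapping.keys e" "i \<in> V"
    by (auto simp: avoiding_def)
  have "e = (e - Poly_Mapping.single i 1) + Poly_Mapping.single i 1"
    using exponent_split_variable[OF i(1)] by (simp only: add.commute)
  then have "monomial e = monomial (e - Poly_Mapping.single i 1) * (variable i :: ('n, 'k) mpoly)"
    by (metis monomial_add variable_def)
  then show "monomial e \<in> P"
    using mpoly_ideal_closed(3)[OF id assms(2)[OF i(2)]] by simp
qed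

text \<open>Let \<open>V\<close> be the set of variables in \<open>P\<close>, the annihilator of the class of \<open>f\<close>. If \<open>P\<close> were
  larger than the ideal generated by \<open>V\<close>, it would contain a nonzero \<open>g\<^sub>2\<close> without variables from
  \<open>V\<close>. Saturating the monomial ideal with respect to the variables outside \<open>V\<close> makes \<open>g\<^sub>2\<close> a
  nonzerodivisor, so \<open>f\<close> lies in the saturation. Hence a monomial outside \<open>V\<close> multiplies \<open>f\<close> into
  the ideal, that is, it lies in \<open>P\<close>; as \<open>P\<close> is prime, so does one of its variables, which is
  absurd.\<close>

lemma associated_prime_eq_variable_prime:
  fixes P :: "('n::finite, 'k::field) mpoly set"
  assumes P: "primeideal P mpoly_ring" and U: "upward_closed U"
    and ann: "P = {r. r * f \<in> monomial_span U}"
  shows "P = variable_prime {i. variable i \<in> P}"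
proof
  define V :: "'n set" where "V = {i. variable i \<in> P}"
  have id: "ideal P mpoly_ring"
    using P by (rule primeideal.axioms)
  show sub: "variable_prime {i. variable i \<in> P} \<subseteq> P"
    by (rule variable_prime_subset_prime[OF P]) simp
  show "P \<subseteq> variable_prime {i. variable i \<in> P}"
  proof
    fix g assume gP: "g \<in> P"
    obtain g\<^sub>1 g\<^sub>2 where g: "g = g\<^sub>1 + g\<^sub>2" "Poly_Mapping.keys g\<^sub>1 = Poly_Mapping.keys g \<inter> - avoiding V"
      "Poly_Mapping.keys g\<^sub>2 = Poly_Mapping.keys g - (- avoiding V)"
      by (rule mpoly_split)
    have "g\<^sub>1 \<in> P"
      using sub g by (auto simp: monomial_span_def V_def)
    then have "g\<^sub>2 \<in> P"
      using mpoly_ideal_closed(2)[OF id gP mpoly_ideal_closed(3)[OF id, of g\<^sub>1 "-1"]] g by simp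
    \<comment> \<open>the exponents of the saturation\<close>
    define W where "W = {e. \<exists>d\<in>avoiding V. e + d \<in> U}"
    have UW: "e \<in> W" if "e \<in> U" for e
      using that by (force simp: W_def intro: bexI[of _ 0])
    have "g\<^sub>2 = 0"
    proof (rule ccontr)
      assume nz: "g\<^sub>2 \<noteq> 0"
      have "f \<in> monomial_span W"
      proof (rule nonzerodivisor_mod_monomial_span[OF _ _ nz])
        show W: "upward_closed W"
          unfolding upward_closed_def
        proof (intro ballI allI)
          fix e d assume "e \<in> W"
          then obtain d' where d': "d' \<in> avoiding V" "e + d' \<in> U"
            by (auto simp: W_def)
          have "e + d + d' = e + d' + d"
            by (simp add: add_ac)
          also have "\<dots> \<in> U"
            by (rule upward_closedD[OF U d'(2)])
          finally show "e + d \<in> W"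
            using d'(1) by (auto simp: W_def)
        qed
        show "determined_by V W"
          unfolding determined_by_def
        proof (intro allI ballI iffI)
          fix e d assume "d \<in> avoiding V" "e + d \<in> W"
          then show "e \<in> W"
            by (force simp: W_def avoiding_add add.assoc)
        next
          fix e d assume "e \<in> W"
          then show "e + d \<in> W"
            by (rule upward_closedD[OF W])
        qed
        show "g\<^sub>2 * f \<in> monomial_span W"
          using \<open>g\<^sub>2 \<in> P\<close> UW by (auto simp: ann monomial_span_def)
      qed (use g in auto)
      then have "\<forall>e\<in>Poly_Mapping.keys f. \<exists>d\<in>avoiding V. e + d \<in> U"
        by (auto simp: monomial_span_def W_def)
      then obtain \<delta> where \<delta>: "\<And>e. e \<in> Poly_Mapping.keys f \<Longrightarrow> \<delta> e \<in> avoiding V \<and> e + \<delta> e \<in> U"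
        by metis
      \<comment> \<open>one monomial that serves all terms of \<open>f\<close> at once\<close>
      define d where "d = (\<Sum>e\<in>Poly_Mapping.keys f. \<delta> e)"
      have "d + e \<in> U" if "e \<in> Poly_Mapping.keys f" for e
      proof -
        have "d + e = e + \<delta> e + (\<Sum>e\<in>Poly_Mapping.keys f - {e}. \<delta> e)"
          using that by (simp add: d_def sum.remove[of _ e] add_ac)
        then show ?thesis
          using \<delta>[OF that] upward_closedD[OF U] by simp
      qed
      then have "monomial d \<in> P"
        by (simp add: ann monomial_mult_in_span_iff)
      then obtain i where i: "i \<in> Poly_Mapping.keys d" "i \<in> V"
        using monomial_in_primeideal_imp_variable[OF P] by (auto simp: V_def)
      have "d \<in> avoiding V"
        unfolding d_def using \<delta> by (intro avoiding_sum) blast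
      with i show False
        by (auto simp: avoiding_def)
    qed
    then show "g \<in> variable_prime {i. variable i \<in> P}"
      using g by (auto simp: monomial_span_def V_def)
  qed
qed

text \<open>The hypotheses say that the monomial with exponent \<open>e\<close> has exactly the ideal generated by
  \<open>V\<close> as its annihilator modulo the monomial ideal.\<close>

lemma variable_prime_associatedI:
  assumes U: "upward_closed U" and e: "\<And>d. d \<in> avoiding V \<Longrightarrow> e + d \<notin> U"
    and nb: "\<And>v. v \<in> V \<Longrightarrow> e + Poly_Mapping.single v 1 \<in> U"
  shows "variable_prime V \<in> associated_primes (mpoly_ring :: ('n::finite, 'k::field) mpoly ring) (monomial_span U)"
proof -
  have "d + e \<in> U \<longleftrightarrow> d \<notin> avoiding V" for d
  proof
    assume "d \<notin> avoiding V"
    then obtain i where i: "i \<in> Poly_Mapping.keys d" "i \<in> V"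
      by (auto simp: avoiding_def)
    have "d + e = (e + Poly_Mapping.single i 1) + (d - Poly_Mapping.single i 1)"
      using arg_cong[OF exponent_split_variable[OF i(1)], of "\<lambda>d. d + e"] by (simp only: ac_simps)
    then show "d + e \<in> U"
      using upward_closedD[OF U nb[OF i(2)]] by simp
  qed (use e in \<open>auto simp: add.commute\<close>)
  then have "(variable_prime V :: ('n, 'k) mpoly set) = {r. r * monomial e \<in> monomial_span U}"
    unfolding mult.commute[of _ "monomial e"] monomial_mult_in_span_iff
    by (auto simp: add.commute monomial_span_def)
  then show ?thesis
    unfolding associated_primes_mpoly_ring[OF ideal_monomial_span[OF U]]
    using primeideal_variable_prime by blast
qed

text \<open>The witness of an associated prime is an arbitrary polynomial, but any of its terms outside
  the ideal is as good, because multiplication by a variable only shifts exponents.\<close>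

lemma variable_prime_associatedD:
  assumes U: "upward_closed U"
    and "variable_prime V \<in> associated_primes (mpoly_ring :: ('n::finite, 'k::field) mpoly ring) (monomial_span U)"
  obtains e where "e \<notin> U" "\<And>v. v \<in> V \<Longrightarrow> e + Poly_Mapping.single v 1 \<in> U"
proof -
  obtain f :: "('n, 'k) mpoly" where f: "variable_prime V = {r. r * f \<in> monomial_span U}"
    using assms unfolding associated_primes_mpoly_ring[OF ideal_monomial_span[OF U]] by blast
  have "1 \<notin> (variable_prime V :: ('n, 'k) mpoly set)"
    by (rule one_notin_primeideal[OF primeideal_variable_prime])
  then obtain e where e: "e \<in> Poly_Mapping.keys f" "e \<notin> U"
    unfolding f by (auto simp: monomial_span_def)
  have "e + Poly_Mapping.single v 1 \<in> U" if "v \<in> V" for v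
  proof -
    have "variable v * f \<in> monomial_span U"
      using that f variable_in_variable_prime_iff[of v V, where 'b = 'k] by blast
    then show ?thesis
      using e by (simp add: variable_def monomial_mult_in_span_iff add.commute)
  qed
  with e that show ?thesis
    by blast
qed

section \<open>Monomial ideals in three of the variables\<close>

definition exponents_at :: "'n \<Rightarrow> 'n \<Rightarrow> 'n \<Rightarrow> ('n::finite \<Rightarrow>\<^sub>0 nat) \<Rightarrow> nat \<times> nat \<times> nat" where
  "exponents_at x y z e = (Poly_Mapping.lookup e x, Poly_Mapping.lookup e y, Poly_Mapping.lookup e z)"

definition vector_at :: "'n \<Rightarrow> 'n \<Rightarrow> 'n \<Rightarrow> nat \<times> nat \<times> nat \<Rightarrow> ('n::finite \<Rightarrow>\<^sub>0 nat)" where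
  "vector_at x y z = (\<lambda>(a, b, d).
     Poly_Mapping.single x a + Poly_Mapping.single y b + Poly_Mapping.single z d)"

lemma exponents_at_add: "exponents_at x y z (d + e) = exponents_at x y z d + exponents_at x y z e"
  by (simp add: exponents_at_def lookup_add)

lemma exponents_at_single:
  assumes "distinct [x, y, z]"
  shows "exponents_at x y z (Poly_Mapping.single x a) = (a, 0, 0)"
    "exponents_at x y z (Poly_Mapping.single y a) = (0, a, 0)"
    "exponents_at x y z (Poly_Mapping.single z a) = (0, 0, a)"
  using assms by (auto simp: exponents_at_def lookup_single when_def)

lemma exponents_at_vector_at:
  assumes "distinct [x, y, z]"
  shows "exponents_at x y z (vector_at x y z t) = t"
  using assms
  by (cases t) (auto simp: exponents_at_add exponents_at_single vector_at_def)

lemma lookup_avoiding: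
  "d \<in> avoiding V \<Longrightarrow> x \<in> V \<Longrightarrow> Poly_Mapping.lookup d x = 0"
  by (auto simp: avoiding_def in_keys_iff)

lemma upward_closed_vimage:
  "upward_closed A \<Longrightarrow> upward_closed (exponents_at x y z -` A)"
  by (auto simp: upward_closed_def exponents_at_add simp del: split_paired_All)

text \<open>The entries of an exponent away from \<open>x\<close>, \<open>y\<close>, \<open>z\<close> are given to one of the two summands, so
  powers of ideals in three variables can be computed with triples.\<close>

lemma vimage_plus_exponents_at:
  assumes "distinct [x, y, z]"
  shows "exponents_at x y z -` A + exponents_at x y z -` B = exponents_at x y z -` (A + B)"
proof (rule equalityI)
  show "exponents_at x y z -` A + exponents_at x y z -` B \<subseteq> exponents_at x y z -` (A + B)"
  proof
    fix e assume "e \<in> exponents_at x y z -` A + exponents_at x y z -` B"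
    then obtain d d' where "e = d + d'" "exponents_at x y z d \<in> A" "exponents_at x y z d' \<in> B"
      by (metis set_plus_elim vimage_eq)
    then show "e \<in> exponents_at x y z -` (A + B)"
      by (metis exponents_at_add set_plus_intro vimage_eq)
  qed
  show "exponents_at x y z -` (A + B) \<subseteq> exponents_at x y z -` A + exponents_at x y z -` B"
  proof
    fix e assume "e \<in> exponents_at x y z -` (A + B)"
    then obtain a b where ab: "a \<in> A" "b \<in> B" "exponents_at x y z e = a + b"
      by (metis set_plus_elim vimage_eq)
    define e' where "e' = e - vector_at x y z a"
    have e: "e = vector_at x y z a + e'"
    proof (rule poly_mapping_eqI)
      fix i
      have "Poly_Mapping.lookup (vector_at x y z a) i \<le> Poly_Mapping.lookup e i"
        using assms ab(3) by (cases a; cases b)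
          (auto simp: vector_at_def lookup_add lookup_single when_def exponents_at_def)
      then show "Poly_Mapping.lookup e i = Poly_Mapping.lookup (vector_at x y z a + e') i"
        by (simp add: e'_def lookup_add lookup_minus)
    qed
    have "a + exponents_at x y z e' = a + b"
      using ab(3) exponents_at_add[of x y z "vector_at x y z a" e']
      unfolding e[symmetric] exponents_at_vector_at[OF assms] by simp
    then have "exponents_at x y z e' = b"
      by simp
    then have "vector_at x y z a \<in> exponents_at x y z -` A" "e' \<in> exponents_at x y z -` B"
      using ab by (simp_all add: exponents_at_vector_at[OF assms])
    then show "e \<in> exponents_at x y z -` A + exponents_at x y z -` B"
      unfolding set_plus_def using e by blast
  qed
qed

lemma sumset_power_vimage:
  assumes "distinct [x, y, z]"
  shows "sumset_power (exponents_at x y z -` A) t = exponents_at x y z -` sumset_power A t"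
  by (induction t) (simp_all add: vimage_plus_exponents_at[OF assms])

section \<open>A family of staircases\<close>

text \<open>The exponents of the monomials in the ideal generated by
  \<open>x\<^sup>5z\<^sup>c\<close>, \<open>x\<^sup>4yz\<^sup>c\<close>, \<open>x\<^sup>2y\<^sup>3z\<^sup>c\<close>, \<open>xy\<^sup>4z\<close>, \<open>y\<^sup>5\<close>. Note the absence of \<open>x\<^sup>3y\<^sup>2z\<^sup>c\<close>.\<close>

definition staircase :: "nat \<Rightarrow> (nat \<times> nat \<times> nat) set" where
  "staircase c = {(a, b, d). 5 \<le> a \<and> c \<le> d \<or> 4 \<le> a \<and> 1 \<le> b \<and> c \<le> d \<or>
     2 \<le> a \<and> 3 \<le> b \<and> c \<le> d \<or> 1 \<le> a \<and> 4 \<le> b \<and> 1 \<le> d \<or> 5 \<le> b}"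

lemma upward_closed_staircase: "upward_closed (staircase c)"
  by (auto simp: upward_closed_def staircase_def)

lemma UNIV_plus_upward_closed:
  fixes A :: "'a::comm_monoid_add set"
  assumes "upward_closed A"
  shows "UNIV + A = A"
proof
  show "UNIV + A \<subseteq> A"
    using upward_closedD2[OF assms] by (auto simp: set_plus_def)
  show "A \<subseteq> UNIV + A"
    unfolding set_plus_def by (force intro: exI[of _ 0])
qed

lemma sumset_power_staircase:
  "sumset_power (staircase c) (Suc 0) = staircase c"
  "sumset_power (staircase c) 2 = staircase c + staircase c"
  "sumset_power (staircase c) 3 = staircase c + staircase c + staircase c"
  by (simp_all add: numeral_2_eq_2 numeral_3_eq_3 UNIV_plus_upward_closed[OF upward_closed_staircase])

text \<open>In \<open>y\<close>-degree 7 of the square, the least \<open>z\<close>-degree \<open>c\<close> needs the factor \<open>y\<^sup>5\<close>, next to which the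
  other factor has \<open>x\<close>-degree at least 4, as in \<open>x\<^sup>4y\<^sup>2z\<^sup>c\<close>. The least \<open>x\<close>-degree 3 arises only from
  \<open>xy\<^sup>4z\<close> and \<open>x\<^sup>2y\<^sup>3z\<^sup>c\<close>, at the price of another \<open>z\<close>. The gap left by \<open>x\<^sup>3y\<^sup>2z\<^sup>c\<close> thus becomes the
  socle monomial \<open>x\<^sup>3y\<^sup>7z\<^sup>c\<close>; its multiple by \<open>y\<close> is divisible by the square of \<open>xy\<^sup>4z\<close>.\<close>

lemma staircase_square_socle:
  assumes "c \<ge> 3"
  shows "(3, 7, c) \<notin> staircase c + staircase c" "(4, 7, c) \<in> staircase c + staircase c"
    "(3, 8, c) \<in> staircase c + staircase c" "(3, 7, Suc c) \<in> staircase c + staircase c"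
proof -
  have plus: "(r, s, t) \<in> staircase c + staircase c"
    if "(a, b, d) \<in> staircase c" "(a', b', d') \<in> staircase c" "r = a + a'" "s = b + b'" "t = d + d'"
    for r s t a b d a' b' d'
    using set_plus_intro[OF that(1,2)] that(3-5) by simp
  show "(4, 7, c) \<in> staircase c + staircase c"
    by (rule plus[of 0 5 0 4 2 c]) (simp_all add: staircase_def)
  show "(3, 8, c) \<in> staircase c + staircase c"
    by (rule plus[of 1 4 1 2 4 "c - 1"]) (use assms in \<open>auto simp: staircase_def\<close>)
  show "(3, 7, Suc c) \<in> staircase c + staircase c"
    by (rule plus[of 1 4 1 2 3 c]) (simp_all add: staircase_def)
  show "(3, 7, c) \<notin> staircase c + staircase c"
  proof
    assume "(3, 7, c) \<in> staircase c + staircase c"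
    then obtain u v where uv: "(3, 7, c) = u + v" "u \<in> staircase c" "v \<in> staircase c"
      by (rule set_plus_elim)
    obtain a b d a' b' d' where [simp]: "u = (a, b, d)" "v = (a', b', d')"
      by (cases u; cases v) blast
    have "a + a' = 3" "b + b' = 7" "d + d' = c"
      using uv(1) by simp_all
    then show False
      using assms uv(2,3) unfolding staircase_def \<open>u = _\<close> \<open>v = _\<close> mem_Collect_eq prod.case
      by (elim disjE conjE; linarith)
  qed
qed

text \<open>In the cube there is enough room to fill the gap: for each \<open>y\<close>-degree \<open>b \<le> 15\<close> the
  least \<open>x\<close>-degree \<open>15 - b\<close> and the least \<open>z\<close>-degree are attained by the same product of three
  generators. At \<open>b = 12\<close> this product is the cube of \<open>xy\<^sup>4z\<close>, and \<open>3 \<le> c\<close> ensures that no other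
  product of \<open>y\<close>-degree at most 12 has a smaller \<open>z\<close>-degree.\<close>

lemma staircase_cube:
  assumes "c \<ge> 3"
  shows "(a, b, d) \<in> staircase c + staircase c + staircase c \<longleftrightarrow>
    15 \<le> a + b \<and> (b \<le> 3 \<longrightarrow> 3 * c \<le> d) \<and> (b \<le> 4 \<longrightarrow> 2 * c + 1 \<le> d) \<and> (b \<le> 7 \<longrightarrow> 2 * c \<le> d) \<and> (b \<le> 8 \<longrightarrow> c + 2 \<le> d) \<and>
    (b \<le> 9 \<longrightarrow> c + 1 \<le> d) \<and> (b \<le> 11 \<longrightarrow> c \<le> d) \<and> (b \<le> 12 \<longrightarrow> 3 \<le> d) \<and> (b \<le> 13 \<longrightarrow> 2 \<le> d) \<and>
    (b \<le> 14 \<longrightarrow> 1 \<le> d)" (is "?L \<longleftrightarrow> ?R")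
proof
  assume ?L
  then obtain u v where uv: "(a, b, d) = u + v" "u \<in> staircase c + staircase c" "v \<in> staircase c"
    by (rule set_plus_elim)
  from uv(2) obtain w w' where w: "u = w + w'" "w \<in> staircase c" "w' \<in> staircase c"
    by (rule set_plus_elim)
  obtain a\<^sub>1 b\<^sub>1 d\<^sub>1 a\<^sub>2 b\<^sub>2 d\<^sub>2 a\<^sub>3 b\<^sub>3 d\<^sub>3 where
    parts: "w = (a\<^sub>1, b\<^sub>1, d\<^sub>1)" "w' = (a\<^sub>2, b\<^sub>2, d\<^sub>2)" "v = (a\<^sub>3, b\<^sub>3, d\<^sub>3)"
    by (cases w; cases w'; cases v) blast
  have eq: "a = a\<^sub>1 + a\<^sub>2 + a\<^sub>3" "b = b\<^sub>1 + b\<^sub>2 + b\<^sub>3" "d = d\<^sub>1 + d\<^sub>2 + d\<^sub>3"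
    using uv(1) w(1) parts by simp_all
  \<comment> \<open>the bound on \<open>a + b\<close> is additive; the \<open>z\<close>-degree is bounded according to whether the \<open>y\<close>-degree
      of a factor is at most 3, equal to 4, or at least 5\<close>
  have degree: "5 \<le> a + b" if "(a, b, d) \<in> staircase c" for a b d
    using that unfolding staircase_def mem_Collect_eq prod.case by (elim disjE; linarith)
  have step: "b \<le> 3 \<and> c \<le> d \<or> b = 4 \<and> 1 \<le> d \<or> 5 \<le> b" if "(a, b, d) \<in> staircase c" for a b d
    using that assms unfolding staircase_def mem_Collect_eq prod.case by (elim disjE; linarith)
  have "15 \<le> a + b"
    using degree[OF w(2)[unfolded parts]] degree[OF w(3)[unfolded parts]]
      degree[OF uv(3)[unfolded parts]] unfolding eq by linarith
  moreover have "(b \<le> 3 \<longrightarrow> 3 * c \<le> d) \<and> (b \<le> 4 \<longrightarrow> 2 * c + 1 \<le> d) \<and> (b \<le> 7 \<longrightarrow> 2 * c \<le> d) \<and>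
    (b \<le> 8 \<longrightarrow> c + 2 \<le> d) \<and> (b \<le> 9 \<longrightarrow> c + 1 \<le> d) \<and> (b \<le> 11 \<longrightarrow> c \<le> d) \<and>
    (b \<le> 12 \<longrightarrow> 3 \<le> d) \<and> (b \<le> 13 \<longrightarrow> 2 \<le> d) \<and> (b \<le> 14 \<longrightarrow> 1 \<le> d)"
    using step[OF w(2)[unfolded parts]] step[OF w(3)[unfolded parts]]
      step[OF uv(3)[unfolded parts]] assms unfolding eq
    by (elim disjE conjE; intro conjI impI; linarith)
  ultimately show ?R
    by blast
next
  assume R: ?R
  have plus: "(a, b, d) \<in> staircase c + staircase c + staircase c"
    if "(a\<^sub>1, b\<^sub>1, d\<^sub>1) \<in> staircase c" "(a\<^sub>2, b\<^sub>2, d\<^sub>2) \<in> staircase c" "(a\<^sub>3, b\<^sub>3, d\<^sub>3) \<in> staircase c"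
      "a\<^sub>1 + a\<^sub>2 + a\<^sub>3 \<le> a" "b\<^sub>1 + b\<^sub>2 + b\<^sub>3 \<le> b" "d\<^sub>1 + d\<^sub>2 + d\<^sub>3 \<le> d"
    for a\<^sub>1 b\<^sub>1 d\<^sub>1 a\<^sub>2 b\<^sub>2 d\<^sub>2 a\<^sub>3 b\<^sub>3 d\<^sub>3
  proof -
    have "(a\<^sub>3, b\<^sub>3, d\<^sub>3) + (a - (a\<^sub>1 + a\<^sub>2 + a\<^sub>3), b - (b\<^sub>1 + b\<^sub>2 + b\<^sub>3), d - (d\<^sub>1 + d\<^sub>2 + d\<^sub>3)) \<in> staircase c"
      using upward_closed_staircase that(3) by (rule upward_closedD)
    then have "(a - (a\<^sub>1 + a\<^sub>2), b - (b\<^sub>1 + b\<^sub>2), d - (d\<^sub>1 + d\<^sub>2)) \<in> staircase c"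
      using that(4-6) by simp
    from set_plus_intro[OF set_plus_intro[OF that(1,2)] this] show ?thesis
      using that(4-6) by simp
  qed
  have gens: "(5, 0, c) \<in> staircase c" "(4, Suc 0, c) \<in> staircase c" "(2, 3, c) \<in> staircase c"
    "(Suc 0, 4, Suc 0) \<in> staircase c" "(0, 5, 0) \<in> staircase c"
    by (auto simp: staircase_def)
  have "b = 0 \<or> b = 1 \<or> b = 2 \<or> b = 3 \<or> b = 4 \<or> b = 5 \<or> b = 6 \<or> b = 7 \<or> b = 8 \<or> b = 9 \<or>
    b = 10 \<or> b = 11 \<or> b = 12 \<or> b = 13 \<or> b = 14 \<or> 15 \<le> b"
    by presburger
  then consider "b = 0" | "b = 1" | "b = 2" | "b = 3" | "b = 4" | "b = 5" | "b = 6" | "b = 7" | "b = 8"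
    | "b = 9" | "b = 10" | "b = 11" | "b = 12" | "b = 13" | "b = 14" | "b \<ge> 15"
    by (elim disjE) assumption+
  then show ?L
  \<comment> \<open>in each case, the product that attains both minima\<close>
  proof cases
    case 1 then show ?thesis using R plus[OF gens(1) gens(1) gens(1)] by simp
  next
    case 2 then show ?thesis using R plus[OF gens(1) gens(1) gens(2)] by simp
  next
    case 3 then show ?thesis using R plus[OF gens(1) gens(2) gens(2)] by simp
  next
    case 4 then show ?thesis using R plus[OF gens(2) gens(2) gens(2)] by simp
  next
    case 5 then show ?thesis using R plus[OF gens(1) gens(1) gens(4)] by simp
  next
    case 6 then show ?thesis using R plus[OF gens(1) gens(1) gens(5)] by simp
  next
    case 7 then show ?thesis using R plus[OF gens(1) gens(2) gens(5)] by simp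
  next
    case 8 then show ?thesis using R plus[OF gens(2) gens(2) gens(5)] by simp
  next
    case 9 then show ?thesis using R plus[OF gens(1) gens(4) gens(4)] by simp
  next
    case 10 then show ?thesis using R plus[OF gens(1) gens(4) gens(5)] by simp
  next
    case 11 then show ?thesis using R plus[OF gens(1) gens(5) gens(5)] by simp
  next
    case 12 then show ?thesis using R plus[OF gens(2) gens(5) gens(5)] by simp
  next
    case 13 then show ?thesis using R plus[OF gens(4) gens(4) gens(4)] by simp
  next
    case 14 then show ?thesis using R plus[OF gens(4) gens(4) gens(5)] by simp
  next
    case 15 then show ?thesis using R plus[OF gens(4) gens(5) gens(5)] by simp
  next
    case 16 then show ?thesis using R plus[OF gens(5) gens(5) gens(5)] by simp
  qed
qed

text \<open>The bounds on \<open>d\<close> do not mention \<open>a\<close> and the bound on \<open>a + b\<close> does not mention \<open>d\<close>, so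
  the first kind is inherited from the neighbour in direction \<open>x\<close> and the second from the
  neighbour in direction \<open>z\<close>. The same happens for the staircase itself.\<close>

lemma staircase_cube_saturated:
  assumes "c \<ge> 3" "(Suc a, b, d) \<in> staircase c + staircase c + staircase c"
    "(a, b, Suc d) \<in> staircase c + staircase c + staircase c"
  shows "(a, b, d) \<in> staircase c + staircase c + staircase c"
  using assms(2,3) unfolding staircase_cube[OF assms(1)]
  by (elim conjE) (intro conjI; assumption)

lemma staircase_saturated:
  assumes "c \<ge> 1" "(Suc a, b, d) \<in> staircase c" "(a, b, Suc d) \<in> staircase c"
  shows "(a, b, d) \<in> staircase c"
  using assms unfolding staircase_def mem_Collect_eq prod.case by (elim disjE; linarith)

text \<open>Powers of \<open>y\<^sup>5\<close> and of \<open>x\<^sup>5z\<^sup>c\<close>: they force every prime over a power of the ideal to contain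
  \<open>y\<close> and one of \<open>x\<close> and \<open>z\<close>.\<close>

lemma sumset_power_staircase_axes:
  "(0, 5 * t, 0) \<in> sumset_power (staircase c) t"
  "(5 * t, 0, c * t) \<in> sumset_power (staircase c) t"
proof (induction t)
  case (Suc t)
  have "(0, 5, 0) \<in> staircase c" "(5, 0, c) \<in> staircase c"
    by (auto simp: staircase_def)
  note this[THEN set_plus_intro[OF Suc.IH(1)]] this[THEN set_plus_intro[OF Suc.IH(2)]]
  then show "(0, 5 * Suc t, 0) \<in> sumset_power (staircase c) (Suc t)"
    "(5 * Suc t, 0, c * Suc t) \<in> sumset_power (staircase c) (Suc t)"
    by (simp_all add: add.commute)
qed auto

section \<open>The associated primes of the powers\<close>

definition staircase_ideal :: "'n \<Rightarrow> 'n \<Rightarrow> 'n \<Rightarrow> nat \<Rightarrow> ('n::finite, 'k::field) mpoly set" where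
  "staircase_ideal x y z c = monomial_span (exponents_at x y z -` staircase c)"

lemma monomial_ideal_staircase_ideal: "monomial_ideal (staircase_ideal x y z c)"
proof -
  have "exponents_at x y z -` staircase c + UNIV = exponents_at x y z -` staircase c"
    unfolding add.commute[of _ UNIV]
    by (intro UNIV_plus_upward_closed upward_closed_vimage upward_closed_staircase)
  then show ?thesis
    unfolding monomial_ideal_def staircase_ideal_def
    by (intro exI[of _ "exponents_at x y z -` staircase c"]) (simp add: genideal_monomials)
qed

lemma ideal_power_staircase_ideal:
  assumes "distinct [x, y, z]"
  shows "ideal_power (mpoly_ring :: ('n::finite, 'k::field) mpoly ring) (staircase_ideal x y z c) t =
    monomial_span (exponents_at x y z -` sumset_power (staircase c) t)"
  unfolding staircase_ideal_def
  by (simp add: ideal_power_monomial_span upward_closed_vimage upward_closed_staircase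
      sumset_power_vimage[OF assms])

text \<open>An associated prime is generated by variables. A variable other than \<open>x\<close>, \<open>y\<close>, \<open>z\<close> is a
  nonzerodivisor modulo the power and cannot occur, and the powers of \<open>y\<^sup>5\<close> and \<open>x\<^sup>5z\<^sup>c\<close> leave
  three possibilities.\<close>

lemma associated_primes_power_staircase_ideal_subset:
  assumes xyz: "distinct [x, y, z]"
  shows "associated_primes (mpoly_ring :: ('n::finite, 'k::field) mpoly ring)
      (ideal_power mpoly_ring (staircase_ideal x y z c) t)
    \<subseteq> {variable_prime {x, y}, variable_prime {y, z}, variable_prime {x, y, z}}"
proof
  define A where "A = sumset_power (staircase c) t"
  define U where "U = exponents_at x y z -` A"
  have U: "upward_closed U"
    by (simp add: U_def A_def upward_closed_vimage upward_closed_sumset_power upward_closed_staircase)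
  fix P :: "('n, 'k) mpoly set"
  assume "P \<in> associated_primes mpoly_ring (ideal_power mpoly_ring (staircase_ideal x y z c) t)"
  then obtain f where P: "primeideal P mpoly_ring" and f: "P = {r. r * f \<in> monomial_span U}"
    unfolding ideal_power_staircase_ideal[OF xyz] A_def[symmetric] U_def[symmetric]
      associated_primes_mpoly_ring[OF ideal_monomial_span[OF U]] by blast
  define V where "V = {i. variable i \<in> P}"
  have PV: "P = variable_prime V"
    unfolding V_def by (rule associated_prime_eq_variable_prime[OF P U f])
  have "V \<subseteq> {x, y, z}"
  proof
    fix i assume "i \<in> V"
    show "i \<in> {x, y, z}"
    proof (rule ccontr)
      assume i: "i \<notin> {x, y, z}"
      then have "exponents_at x y z (Poly_Mapping.single i 1 + e) = exponents_at x y z e" for e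
        by (auto simp: exponents_at_def lookup_add lookup_single when_def)
      moreover have "variable i * f \<in> monomial_span U"
        using \<open>i \<in> V\<close> f by (auto simp: V_def)
      ultimately have "f \<in> monomial_span U"
        unfolding variable_def monomial_mult_in_span_iff U_def vimage_eq
        by (auto simp: monomial_span_def)
      then show False
        using one_notin_primeideal[OF P] f by simp
    qed
  qed
  have hit: "\<exists>i\<in>Poly_Mapping.keys (vector_at x y z u). i \<in> V" if "u \<in> A" for u
  proof -
    have "monomial (vector_at x y z u) \<in> monomial_span U"
      using that by (simp add: monomial_in_span_iff U_def exponents_at_vector_at[OF xyz])
    then have "monomial (vector_at x y z u) \<in> P"
      using monomial_span_mult[OF U, of "monomial (vector_at x y z u)" f]
      by (simp add: f mult.commute)
    then show ?thesis
      using monomial_in_primeideal_imp_variable[OF P] by (auto simp: V_def)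
  qed
  have "y \<in> V"
    using hit[OF sumset_power_staircase_axes(1)[of t c, folded A_def]]
    by (auto simp: vector_at_def in_keys_iff lookup_add lookup_single when_def split: if_splits)
  have "x \<in> V \<or> z \<in> V"
    using hit[OF sumset_power_staircase_axes(2)[of t c, folded A_def]]
    by (auto simp: vector_at_def in_keys_iff lookup_add lookup_single when_def split: if_splits)
  have "V = {v \<in> {x, y, z}. v \<in> V}"
    using \<open>V \<subseteq> {x, y, z}\<close> by blast
  moreover have "{v \<in> {x, y, z}. v \<in> V} = (if x \<in> V then {x} else {}) \<union> {y} \<union> (if z \<in> V then {z} else {})"
    using \<open>y \<in> V\<close> by auto
  ultimately have "V = {x, y} \<or> V = {y, z} \<or> V = {x, y, z}"
    using \<open>x \<in> V \<or> z \<in> V\<close> by (cases "x \<in> V"; cases "z \<in> V") (simp_all add: insert_commute)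
  then show "P \<in> {variable_prime {x, y}, variable_prime {y, z}, variable_prime {x, y, z}}"
    unfolding PV by (elim disjE) simp_all
qed

lemma associated_xyz_prime_iff_socle:
  assumes xyz: "distinct [x, y, z]" and A: "upward_closed A"
  shows "variable_prime {x, y, z} \<in> associated_primes (mpoly_ring :: ('n::finite, 'k::field) mpoly ring)
      (monomial_span (exponents_at x y z -` A)) \<longleftrightarrow>
    (\<exists>a b d. (a, b, d) \<notin> A \<and> (Suc a, b, d) \<in> A \<and> (a, Suc b, d) \<in> A \<and> (a, b, Suc d) \<in> A)"
    (is "?L \<longleftrightarrow> ?R")
proof
  assume ?L
  then obtain e where e: "e \<notin> exponents_at x y z -` A"
    "\<And>v. v \<in> {x, y, z} \<Longrightarrow> e + Poly_Mapping.single v 1 \<in> exponents_at x y z -` A"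
    using variable_prime_associatedD[OF upward_closed_vimage[OF A]] by metis
  obtain a b d where abd: "exponents_at x y z e = (a, b, d)"
    by (metis prod_cases3)
  show ?R
    using e(1) e(2)[of x] e(2)[of y] e(2)[of z]
    by (intro exI[of _ a] exI[of _ b] exI[of _ d])
       (simp add: exponents_at_add abd exponents_at_single[OF xyz])
next
  assume ?R
  then obtain a b d where abd: "(a, b, d) \<notin> A" "(Suc a, b, d) \<in> A" "(a, Suc b, d) \<in> A" "(a, b, Suc d) \<in> A"
    by blast
  show ?L
  proof (rule variable_prime_associatedI[OF upward_closed_vimage[OF A], where e = "vector_at x y z (a, b, d)"])
    fix v assume "v \<in> {x, y, z}"
    then show "vector_at x y z (a, b, d) + Poly_Mapping.single v 1 \<in> exponents_at x y z -` A"
      using abd by (auto simp: exponents_at_add exponents_at_vector_at[OF xyz] exponents_at_single[OF xyz])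
  next
    fix d' assume "d' \<in> avoiding {x, y, z}"
    then have "exponents_at x y z d' = 0"
      by (simp add: exponents_at_def lookup_avoiding zero_prod_def)
    then show "vector_at x y z (a, b, d) + d' \<notin> exponents_at x y z -` A"
      using abd by (simp add: exponents_at_add exponents_at_vector_at[OF xyz])
  qed
qed

lemma minimal_primes_staircase_ideal:
  assumes xyz: "distinct [x, y, z]" and c: "c \<ge> 1"
  shows "minimal_primes (mpoly_ring :: ('n::finite, 'k::field) mpoly ring) (staircase_ideal x y z c)
    = {variable_prime {x, y}, variable_prime {y, z}}"
proof -
  let ?R = "mpoly_ring :: ('n, 'k) mpoly ring"
  let ?I = "staircase_ideal x y z c :: ('n, 'k) mpoly set"
  let ?Q = "\<lambda>V. variable_prime V :: ('n, 'k) mpoly set"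
  have contains: "?I \<subseteq> ?Q V" if "y \<in> V" "x \<in> V \<or> z \<in> V" for V
  proof -
    have "e \<notin> avoiding V" if "exponents_at x y z e \<in> staircase c" for e
      using that \<open>y \<in> V\<close> \<open>x \<in> V \<or> z \<in> V\<close> c lookup_avoiding[of e V]
      by (auto simp: exponents_at_def staircase_def)
    then show ?thesis
      by (auto simp: staircase_ideal_def monomial_span_def)
  qed
  have above: "?Q {x, y} \<subseteq> P \<or> ?Q {y, z} \<subseteq> P" if P: "primeideal P ?R" and sub: "?I \<subseteq> P" for P
  proof -
    have hit: "\<exists>i\<in>Poly_Mapping.keys (vector_at x y z u). variable i \<in> P" if "u \<in> staircase c" for u
    proof (rule monomial_in_primeideal_imp_variable[OF P])
      have "monomial (vector_at x y z u) \<in> ?I"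
        using that by (simp add: staircase_ideal_def monomial_in_span_iff exponents_at_vector_at[OF xyz])
      then show "monomial (vector_at x y z u) \<in> P"
        using sub by blast
    qed
    have "variable y \<in> P"
      using hit[of "(0, 5, 0)"]
      by (auto simp: staircase_def vector_at_def in_keys_iff lookup_add lookup_single when_def
          split: if_splits)
    moreover have "variable x \<in> P \<or> variable z \<in> P"
      using hit[of "(5, 0, c)"]
      by (auto simp: staircase_def vector_at_def in_keys_iff lookup_add lookup_single when_def
          split: if_splits)
    ultimately show ?thesis
      using variable_prime_subset_prime[OF P, of "{x, y}"] variable_prime_subset_prime[OF P, of "{y, z}"]
      by auto
  qed
  have minimal: "?Q V \<in> minimal_primes ?R ?I" if V: "V \<in> {{x, y}, {y, z}}" for V
  proof -
    have "Q = ?Q V" if Q: "primeideal Q ?R" "?I \<subseteq> Q" "Q \<subseteq> ?Q V" for Q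
    proof -
      obtain W where W: "W \<in> {{x, y}, {y, z}}" "?Q W \<subseteq> Q"
        using above[OF Q(1,2)] by blast
      then have "W \<subseteq> V"
        using Q(3) variable_prime_subset_iff by (metis subset_trans)
      then have "W = V"
        using W(1) V xyz by auto
      then show ?thesis
        using W(2) Q(3) by (intro equalityI) simp_all
    qed
    moreover have "?I \<subseteq> ?Q V"
      using V by (intro contains) auto
    ultimately show ?thesis
      using primeideal_variable_prime by (simp add: minimal_primes_def)
  qed
  show ?thesis
  proof (intro equalityI subsetI)
    fix P assume "P \<in> minimal_primes ?R ?I"
    then have P: "primeideal P ?R" "?I \<subseteq> P"
      and min: "\<And>Q. primeideal Q ?R \<Longrightarrow> ?I \<subseteq> Q \<Longrightarrow> Q \<subseteq> P \<Longrightarrow> Q = P"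
      by (auto simp: minimal_primes_def)
    obtain V where V: "V \<in> {{x, y}, {y, z}}" "?Q V \<subseteq> P"
      using above[OF P] by blast
    moreover have "?I \<subseteq> ?Q V"
      using V(1) by (intro contains) auto
    ultimately have "?Q V = P"
      by (intro min primeideal_variable_prime)
    then show "P \<in> {?Q {x, y}, ?Q {y, z}}"
      using V(1) by blast
  qed (use minimal in blast)
qed

text \<open>The witnesses are \<open>y\<^sup>4z\<^sup>c\<close>, which needs an \<open>x\<close> or a \<open>y\<close> to enter the ideal, and \<open>xy\<^sup>4\<close>, which
  needs a \<open>y\<close> or a \<open>z\<close>.\<close>

lemma minimal_primes_of_staircase_ideal_associated:
  assumes xyz: "distinct [x, y, z]" and c: "c \<ge> 1"
  shows "{variable_prime {x, y}, variable_prime {y, z}} \<subseteq>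
    associated_primes (mpoly_ring :: ('n::finite, 'k::field) mpoly ring) (staircase_ideal x y z c)"
proof -
  let ?S = "exponents_at x y z -` staircase c"
  have up: "upward_closed ?S"
    by (simp add: upward_closed_vimage upward_closed_staircase)
  have "variable_prime {x, y} \<in> associated_primes (mpoly_ring :: ('n, 'k) mpoly ring) (monomial_span ?S)"
  proof (rule variable_prime_associatedI[OF up, where e = "vector_at x y z (0, 4, c)"])
    fix d assume "d \<in> avoiding {x, y}"
    then show "vector_at x y z (0, 4, c) + d \<notin> ?S"
      unfolding vimage_eq exponents_at_add exponents_at_vector_at[OF xyz]
      by (simp add: exponents_at_def lookup_avoiding staircase_def)
  qed (use c in \<open>auto simp: exponents_at_add exponents_at_vector_at[OF xyz]
        exponents_at_single[OF xyz] staircase_def\<close>)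
  moreover have "variable_prime {y, z} \<in>
    associated_primes (mpoly_ring :: ('n, 'k) mpoly ring) (monomial_span ?S)"
  proof (rule variable_prime_associatedI[OF up, where e = "vector_at x y z (1, 4, 0)"])
    fix d assume "d \<in> avoiding {y, z}"
    then show "vector_at x y z (1, 4, 0) + d \<notin> ?S"
      unfolding vimage_eq exponents_at_add exponents_at_vector_at[OF xyz]
      using c by (simp add: exponents_at_def lookup_avoiding staircase_def)
  qed (use c in \<open>auto simp: exponents_at_add exponents_at_vector_at[OF xyz]
        exponents_at_single[OF xyz] staircase_def\<close>)
  ultimately show ?thesis
    by (simp add: staircase_ideal_def)
qed

lemma monomial_prime_ideal_variable_prime:
  "monomial_prime_ideal (variable_prime V)"
proof -
  have "- avoiding V = (\<lambda>i. Poly_Mapping.single i 1) ` V + UNIV"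
  proof (intro equalityI subsetI)
    fix e assume "e \<in> - avoiding V"
    then obtain i where i: "i \<in> Poly_Mapping.keys e" "i \<in> V"
      by (auto simp: avoiding_def)
    then show "e \<in> (\<lambda>i. Poly_Mapping.single i 1) ` V + UNIV"
      using exponent_split_variable[OF i(1)] unfolding set_plus_def by blast
  qed (auto simp: set_plus_def avoiding_add, simp add: avoiding_def)
  then show ?thesis
    unfolding monomial_prime_ideal_def variable_def
    by (metis genideal_monomials image_image)
qed

lemma nearly_normally_torsion_free_staircase_ideal:
  assumes xyz: "distinct [x, y, z]" and c: "c \<ge> 1"
  shows "nearly_normally_torsion_free (staircase_ideal x y z c :: ('n::finite, 'k::field) mpoly set)"
proof -
  let ?R = "mpoly_ring :: ('n, 'k) mpoly ring"
  let ?I = "staircase_ideal x y z c :: ('n, 'k) mpoly set"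
  let ?P = "variable_prime {x, y, z} :: ('n, 'k) mpoly set"
  have one: "ideal_power ?R ?I 1 = ?I"
    unfolding ideal_power_staircase_ideal[OF xyz] One_nat_def sumset_power_staircase(1)
    by (simp add: staircase_ideal_def)
  have "?P \<notin> associated_primes ?R ?I"
    unfolding staircase_ideal_def
      associated_xyz_prime_iff_socle[OF xyz upward_closed_staircase]
    using staircase_saturated[OF c] by blast
  then have "associated_primes ?R ?I = minimal_primes ?R ?I"
    using associated_primes_power_staircase_ideal_subset[OF xyz, of c 1, where 'k = 'k]
      minimal_primes_of_staircase_ideal_associated[OF xyz c, where 'k = 'k]
    unfolding one minimal_primes_staircase_ideal[OF xyz c] by blast
  then have "\<forall>t. 1 \<le> t \<and> t \<le> 1 \<longrightarrow> associated_primes ?R (ideal_power ?R ?I t) = minimal_primes ?R ?I"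
    using one by (metis le_antisym)
  moreover have "associated_primes ?R (ideal_power ?R ?I t) \<subseteq> minimal_primes ?R ?I \<union> {?P}" for t
    using associated_primes_power_staircase_ideal_subset[OF xyz, of c t, where 'k = 'k]
    unfolding minimal_primes_staircase_ideal[OF xyz c] by blast
  ultimately show ?thesis
    unfolding nearly_normally_torsion_free_def
    by (intro conjI exI[of _ ?P] exI[of _ 1] monomial_ideal_staircase_ideal
        monomial_prime_ideal_variable_prime) simp_all
qed

lemma not_persistence_staircase_ideal:
  assumes xyz: "distinct [x, y, z]" and c: "c \<ge> 3"
  shows "\<not> persistence_property mpoly_ring (staircase_ideal x y z c :: ('n::finite, 'k::field) mpoly set)"
proof
  let ?R = "mpoly_ring :: ('n, 'k) mpoly ring"
  let ?I = "staircase_ideal x y z c :: ('n, 'k) mpoly set"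
  let ?P = "variable_prime {x, y, z} :: ('n, 'k) mpoly set"
  have assoc: "?P \<in> associated_primes ?R (ideal_power ?R ?I t) \<longleftrightarrow>
    (\<exists>a b d. (a, b, d) \<notin> sumset_power (staircase c) t \<and> (Suc a, b, d) \<in> sumset_power (staircase c) t \<and>
      (a, Suc b, d) \<in> sumset_power (staircase c) t \<and> (a, b, Suc d) \<in> sumset_power (staircase c) t)" for t
    unfolding ideal_power_staircase_ideal[OF xyz]
    by (rule associated_xyz_prime_iff_socle[OF xyz upward_closed_sumset_power[OF upward_closed_staircase]])
  have "?P \<in> associated_primes ?R (ideal_power ?R ?I 2)"
    unfolding assoc sumset_power_staircase(2)
    using staircase_square_socle[OF c]
    by (intro exI[of _ 3] exI[of _ 7] exI[of _ c]) simp
  moreover assume "persistence_property ?R ?I"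
  then have "associated_primes ?R (ideal_power ?R ?I 2) \<subseteq> associated_primes ?R (ideal_power ?R ?I 3)"
    unfolding persistence_property_def by (elim allE[of _ 2]) simp
  ultimately have "?P \<in> associated_primes ?R (ideal_power ?R ?I 3)"
    by (rule rev_subsetD)
  then show False
    unfolding assoc sumset_power_staircase(3)
    using staircase_cube_saturated[OF c] by blast
qed

text \<open>The parameter is recovered as the least \<open>d\<close> such that \<open>x\<^sup>5z\<^sup>d\<close> lies in the ideal.\<close>

lemma inj_staircase_ideal:
  assumes xyz: "distinct [x, y, z]"
  shows "inj (staircase_ideal x y z :: nat \<Rightarrow> ('n::finite, 'k::field) mpoly set)"
proof (rule injI)
  fix c c'
  assume eq: "staircase_ideal x y z c = (staircase_ideal x y z c' :: ('n, 'k) mpoly set)"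
  have mem: "(monomial (vector_at x y z (5, 0, d)) :: ('n, 'k) mpoly) \<in> staircase_ideal x y z c \<longleftrightarrow> c \<le> d"
    for c d
    by (simp add: staircase_ideal_def monomial_in_span_iff exponents_at_vector_at[OF xyz] staircase_def)
  show "c = c'"
    using mem[of c c] mem[of c c'] mem[of c' c] mem[of c' c'] unfolding eq by auto
qed

theorem proposition5p14:
  assumes "CARD('n::finite) \<ge> 3"
  shows "infinite {I :: ('n, 'k::field) mpoly set.
           monomial_ideal I \<and> nearly_normally_torsion_free I \<and>
           \<not> persistence_property mpoly_ring I}"
proof -
  obtain T :: "'n set" where T: "card T = 3"
    using obtain_subset_with_card_n[OF assms] by blast
  then obtain x y z where "T = {x, y, z}" "x \<noteq> y" "y \<noteq> z" "x \<noteq> z"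
    unfolding card_3_iff by blast
  then have xyz: "distinct [x, y, z]"
    by simp
  have "infinite (staircase_ideal x y z ` {3..} :: ('n, 'k) mpoly set set)"
    unfolding finite_image_iff[OF inj_on_subset[OF inj_staircase_ideal[OF xyz] subset_UNIV]]
    by (rule infinite_Ici)
  then show ?thesis
  proof (rule infinite_super[rotated])
    show "staircase_ideal x y z ` {3..} \<subseteq> {I :: ('n, 'k) mpoly set.
           monomial_ideal I \<and> nearly_normally_torsion_free I \<and> \<not> persistence_property mpoly_ring I}"
    proof (intro image_subsetI CollectI conjI)
      fix c :: nat assume "c \<in> {3..}"
      then have c: "c \<ge> 3" "c \<ge> 1"
        by simp_all
      show "monomial_ideal (staircase_ideal x y z c :: ('n, 'k) mpoly set)"
        by (rule monomial_ideal_staircase_ideal)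
      show "nearly_normally_torsion_free (staircase_ideal x y z c :: ('n, 'k) mpoly set)"
        by (rule nearly_normally_torsion_free_staircase_ideal[OF xyz c(2)])
      show "\<not> persistence_property mpoly_ring (staircase_ideal x y z c :: ('n, 'k) mpoly set)"
        by (rule not_persistence_staircase_ideal[OF xyz c(1)])
    qed
  qed
qed

end
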